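(* Let $\lambda$ be a positive integer and put $T_\lambda=\max(10^5,\,7\lambda+43)$. Every nontrivial graphical $t$-$\bigl(\binom{n}{2}, k, \lambda\bigr)$ design with $t \geq 2$ satisfies \[ t < 2.3\, T_\lambda^2,\qquad n < 4.7\, T_\lambda^2,\qquad\text{and}\qquad k < 11.1\, T_\lambda^4 . \]
   Context: For positive integers $t,\lambda$, an integer $k \ge t$ and a set $X$ of cardinality $v$, a $t$-$(v,k,\lambda)$ design is a pair $(X,\mathcal{B})$, where $\mathcal{B}$ is a finite multiset of $k$-subsets of $X$ such that every $t$-subset of $X$ is contained in exactly $\lambda$ members of $\mathcal{B}$, counted with multiplicity. The multiplicity of a $k$-subset $B$ in $\mathcal{B}$ is denoted $\mu_{\mathcal{B}}(B)$. The design is empty if $\mu_{\mathcal{B}}(B)=0$ for every $k$-subset $B$ of $X$; it contains the complete design if $\mu_{\mathcal{B}}(B)\ge 1$ for every $k$-subset $B$ of $X$. It is nontrivial if $t<k<v$ and it neither is empty nor contains the complete design. $V$ is an $n$-element set, $K_n$ is the complete graph with vertex set $V$, and $X=E(K_n)=\binom{V}{2}$ is the set of all $2$-subsets of $V$. The symmetric group $\mathrm{Sym}(V)$ acts on $X$ by $\sigma(\{x,y\})=\{\sigma(x),\sigma(y)\}$ and on subsets of $X$ elementwise. A $t$-$\bigl(\binom n2,k,\lambda\bigr)$ design on $X=E(K_n)$ is graphical if $\mu_{\mathcal{B}}(\sigma(B))=\mu_{\mathcal{B}}(B)$ for all $\sigma\in\mathrm{Sym}(V)$ and all $k$-subsets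 $B$ of $X$. *)

theory Defs
  imports Complex_Main "HOL-Library.Multiset" "HOL-Library.Ramsey"
    "HOL-Combinatorics.Permutations"
begin

definition design :: "nat \<Rightarrow> nat \<Rightarrow> nat \<Rightarrow> nat \<Rightarrow> 'a set \<Rightarrow> 'a set multiset \<Rightarrow> bool" where
  "design t v k lam X \<B> \<longleftrightarrow>
     0 < t \<and> 0 < lam \<and> t \<le> k \<and> finite X \<and> card X = v \<and>
     set_mset \<B> \<subseteq> nsets X k \<and>
     (\<forall>S \<in> nsets X t. size {#B \<in># \<B>. S \<subseteq> B#} = lam)"

definition empty_design :: "nat \<Rightarrow> 'a set \<Rightarrow> 'a set multiset \<Rightarrow> bool" where
  "empty_design k X \<B> \<longleftrightarrow> (\<forall>B \<in> nsets X k. count \<B> B = 0)"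

definition contains_complete :: "nat \<Rightarrow> 'a set \<Rightarrow> 'a set multiset \<Rightarrow> bool" where
  "contains_complete k X \<B> \<longleftrightarrow> (\<forall>B \<in> nsets X k. 1 \<le> count \<B> B)"

definition nontrivial_design ::
    "nat \<Rightarrow> nat \<Rightarrow> nat \<Rightarrow> nat \<Rightarrow> 'a set \<Rightarrow> 'a set multiset \<Rightarrow> bool" where
  "nontrivial_design t v k lam X \<B> \<longleftrightarrow>
     design t v k lam X \<B> \<and> t < k \<and> k < v \<and>
     \<not> empty_design k X \<B> \<and> \<not> contains_complete k X \<B>"

definition complete_edges :: "'a set \<Rightarrow> 'a set set" where
  "complete_edges V = nsets V 2"

text \<open>A permutation \<open>\<sigma>\<close> sends the edge \<open>e\<close> to \<open>\<sigma> ` e\<close>, hence the block \<open>B\<close>, a set of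
  edges, to \<open>(`) \<sigma> ` B\<close>.\<close>

definition graphical :: "'a set \<Rightarrow> nat \<Rightarrow> 'a set set multiset \<Rightarrow> bool" where
  "graphical V k \<B> \<longleftrightarrow>
     (\<forall>\<sigma> B. \<sigma> permutes V \<longrightarrow> B \<in> nsets (complete_edges V) k \<longrightarrow>
        count \<B> ((`) \<sigma> ` B) = count \<B> B)"

definition T_bound :: "nat \<Rightarrow> nat" where
  "T_bound lam = max (10 ^ 5) (7 * lam + 43)"

end

theory Submission
  imports Defs
begin

text \<open>
  If a \<open>t\<close>-subset \<open>S\<close> of a block \<open>B\<close> leaves a set \<open>F\<close> of at least \<open>2\<lambda>\<close> vertices uncovered, then
  the images of \<open>B\<close> under transpositions in \<open>F\<close> are blocks containing \<open>S\<close>, and as there are only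
  \<open>\<lambda>\<close> of these, the vertices in \<open>F\<close> are pairwise twins in the graph \<open>B\<close>. Take \<open>S\<close> to be \<open>t - 2\<close> edges
  packed into a set \<open>U\<close> of about \<open>sqrt (2 t)\<close> vertices together with two disjoint edges in the
  complement \<open>W\<close> of \<open>U\<close>. Varying \<open>S\<close> inside a block containing it shows that the block induces a
  clique on \<open>W\<close>; trading the edges of \<open>S\<close> at a vertex \<open>u\<close> of \<open>U\<close> for edges of that clique shows
  that \<open>u\<close> is a twin of the vertices in \<open>W\<close>. So the block is complete, a contradiction whenever \<open>W\<close>
  is large compared with \<open>\<lambda>\<close> and \<open>sqrt (card U)\<close>.

  Large \<open>n\<close> compared with \<open>t\<close> is thereby excluded directly. For large \<open>t\<close>, nontriviality gives
  \<open>k + t < v\<close>: otherwise inclusion-exclusion over the complement of a \<open>k\<close>-set determines its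
  multiplicity, which is then constant. Hence \<open>n choose 2 > 2 t\<close> and \<open>n > 2 sqrt t\<close>, which
  exceeds \<open>card U\<close> by a constant multiple of \<open>sqrt t\<close>.
\<close>

section \<open>Blocks meeting and avoiding prescribed points\<close>

text \<open>Counts pairs of a point \<open>x\<close> outside \<open>J\<close> and a block containing
  \<open>insert x J\<close> in two ways: a block containing \<open>J\<close> has
  \<open>k - card J\<close> further points.\<close>

lemma sum_size_filter_insert:
  assumes "finite X" "J \<subseteq> X" "\<forall>B\<in>#M. B \<subseteq> X \<and> card B = k"
  shows "(\<Sum>x\<in>X - J. size {#B \<in># M. insert x J \<subseteq> B#}) = (k - card J) * size {#B \<in># M. J \<subseteq> B#}"
  using assms(3)
proof (induction M)
  case empty
  then show ?case by simp
next
  case (add A M)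
  have A: "A \<subseteq> X" "card A = k" using add.prems by auto
  have IH: "(\<Sum>x\<in>X - J. size {#B \<in># M. insert x J \<subseteq> B#}) = (k - card J) * size {#B \<in># M. J \<subseteq> B#}"
    using add by auto
  have "(\<Sum>x\<in>X - J. size {#B \<in># add_mset A M. insert x J \<subseteq> B#}) =
     (\<Sum>x\<in>X - J. size {#B \<in># M. insert x J \<subseteq> B#} + (if insert x J \<subseteq> A then 1 else 0))"
    by (intro sum.cong) auto
  also have "\<dots> = (\<Sum>x\<in>X - J. size {#B \<in># M. insert x J \<subseteq> B#}) + card {x \<in> X - J. insert x J \<subseteq> A}"
    using assms(1) by (simp only: sum.distrib card_eq_sum sum.inter_filter finite_Diff)
  also have "{x \<in> X - J. insert x J \<subseteq> A} = (if J \<subseteq> A then A - J else {})"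
    using A by auto
  also have "card \<dots> = (if J \<subseteq> A then k - card J else 0)"
    using A assms(1,2) by (auto simp: card_Diff_subset finite_subset)
  finally show ?case using IH by auto
qed

text \<open>Downward induction from \<open>t\<close>: double counting expresses the count at
  \<open>i\<close> through the one at \<open>i + 1\<close>, and \<open>k - i\<close> can be divided
  out since \<open>i < t \<le> k\<close>.\<close>

lemma design_count_superset_constant:
  assumes "design t v k lam X \<B>" "i \<le> t"
  shows "\<exists>c. \<forall>J \<in> nsets X i. size {#B \<in># \<B>. J \<subseteq> B#} = c"
  using assms(2)
proof (induction rule: inc_induct)
  case base
  then show ?case using assms(1) by (auto simp: design_def)
next
  case (step i)
  have X: "finite X" "card X = v" "\<forall>B\<in>#\<B>. B \<subseteq> X \<and> card B = k" "t \<le> k"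
    using assms(1) by (auto simp: design_def nsets_def)
  obtain c where c: "\<And>J. J \<in> nsets X (Suc i) \<Longrightarrow> size {#B \<in># \<B>. J \<subseteq> B#} = c"
    using step by blast
  have "size {#B \<in># \<B>. J \<subseteq> B#} = (v - i) * c div (k - i)" if J: "J \<in> nsets X i" for J
  proof -
    have J': "J \<subseteq> X" "finite J" "card J = i" using J by (auto simp: nsets_def)
    have "(\<Sum>x\<in>X - J. size {#B \<in># \<B>. insert x J \<subseteq> B#}) = (\<Sum>x\<in>X - J. c)"
      by (intro sum.cong refl c) (use J' in \<open>auto simp: nsets_def\<close>)
    then have "(k - i) * size {#B \<in># \<B>. J \<subseteq> B#} = (v - i) * c"
      using sum_size_filter_insert[OF X(1) J'(1) X(3)] J' X by (simp add: card_Diff_subset)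
    then show ?thesis
      using step X(4) by (metis div_mult_self1_is_m zero_less_diff order.strict_trans2)
  qed
  then show ?case by blast
qed

text \<open>Inclusion-exclusion one point at a time: blocks avoiding \<open>x\<close> are all blocks
  minus those containing \<open>x\<close>. A point of \<open>I\<close> is dropped or moves to
  \<open>J\<close>, so \<open>i + j\<close> never grows.\<close>

lemma design_count_superset_disjoint_constant:
  assumes "design t v k lam X \<B>" "i + j \<le> t"
  shows "\<exists>c. \<forall>J \<in> nsets X j. \<forall>I \<in> nsets X i. J \<inter> I = {} \<longrightarrow>
    size {#B \<in># \<B>. J \<subseteq> B \<and> B \<inter> I = {}#} = c"
  using assms(2)
proof (induction i arbitrary: j)
  case 0
  then show ?case using design_count_superset_constant[OF assms(1), of j] by (auto simp: nsets_def)
next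
  case (Suc i)
  obtain c where c: "\<And>J I. J \<in> nsets X j \<Longrightarrow> I \<in> nsets X i \<Longrightarrow> J \<inter> I = {} \<Longrightarrow>
    size {#B \<in># \<B>. J \<subseteq> B \<and> B \<inter> I = {}#} = c"
    using Suc.IH[of j] Suc.prems by auto
  obtain d where d: "\<And>J I. J \<in> nsets X (Suc j) \<Longrightarrow> I \<in> nsets X i \<Longrightarrow> J \<inter> I = {} \<Longrightarrow>
    size {#B \<in># \<B>. J \<subseteq> B \<and> B \<inter> I = {}#} = d"
    using Suc.IH[of "Suc j"] Suc.prems by auto
  have "size {#B \<in># \<B>. J \<subseteq> B \<and> B \<inter> I = {}#} = c - d"
    if J: "J \<in> nsets X j" and I: "I \<in> nsets X (Suc i)" and JI: "J \<inter> I = {}" for J I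
  proof -
    obtain x I' where x: "I = insert x I'" "x \<notin> I'" "card I' = i"
      using I by (auto simp: nsets_def card_Suc_eq)
    have I': "I' \<in> nsets X i" "x \<in> X" using I x by (auto simp: nsets_def)
    have J': "insert x J \<in> nsets X (Suc j)" using J JI x I' by (auto simp: nsets_def)
    have "{#B \<in># \<B>. J \<subseteq> B \<and> B \<inter> I' = {}#} =
      {#B \<in># \<B>. J \<subseteq> B \<and> B \<inter> I = {}#} + {#B \<in># \<B>. insert x J \<subseteq> B \<and> B \<inter> I' = {}#}"
      by (rule multiset_eqI) (auto simp: x)
    then have "size {#B \<in># \<B>. J \<subseteq> B \<and> B \<inter> I' = {}#} =
      size {#B \<in># \<B>. J \<subseteq> B \<and> B \<inter> I = {}#} + size {#B \<in># \<B>. insert x J \<subseteq> B \<and> B \<inter> I' = {}#}"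
      by simp
    then show ?thesis using c[OF J I'(1)] d[OF J' I'(1)] JI x by auto
  qed
  then show ?case by blast
qed

lemma nontrivial_design_bound:
  assumes "nontrivial_design t v k lam X \<B>"
  shows "k + t < v"
proof (rule ccontr)
  assume "\<not> k + t < v"
  have D: "design t v k lam X \<B>" "k < v" "\<not> empty_design k X \<B>" "\<not> contains_complete k X \<B>"
    using assms by (auto simp: nontrivial_design_def)
  have X: "finite X" "card X = v" "set_mset \<B> \<subseteq> nsets X k"
    using D by (auto simp: design_def)
  \<comment> \<open>The complement of a \<open>k\<close>-set \<open>B\<close> has at most
    \<open>t\<close> points and is avoided by no block other than \<open>B\<close>, so its avoidance
    count is the multiplicity of \<open>B\<close>. All multiplicities are therefore equal.\<close>
  have "v - k + 0 \<le> t" using \<open>\<not> k + t < v\<close> by simp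
  from design_count_superset_disjoint_constant[OF D(1) this]
  obtain c where c': "\<forall>J \<in> nsets X 0. \<forall>I \<in> nsets X (v - k). J \<inter> I = {} \<longrightarrow>
    size {#B \<in># \<B>. J \<subseteq> B \<and> B \<inter> I = {}#} = c" ..
  have c: "size {#B \<in># \<B>. B \<inter> I = {}#} = c" if "I \<in> nsets X (v - k)" for I
    using bspec[OF c', of "{}"] that by (auto simp: nsets_def)
  have "count \<B> B = c" if B: "B \<in> nsets X k" for B
  proof -
    have B': "B \<subseteq> X" "finite B" "card B = k" using B by (auto simp: nsets_def)
    have "A \<inter> (X - B) = {} \<longleftrightarrow> A = B" if "A \<in># \<B>" for A
    proof -
      have "A \<subseteq> X" "card A = k" using that X by (auto simp: nsets_def)
      then show ?thesis using B' card_subset_eq[of B A] by auto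
    qed
    then have "{#A \<in># \<B>. A \<inter> (X - B) = {}#} = {#A \<in># \<B>. A = B#}"
      by (intro filter_mset_cong) auto
    then have "count \<B> B = size {#A \<in># \<B>. A \<inter> (X - B) = {}#}"
      by (simp add: filter_eq_replicate_mset)
    also have "\<dots> = c"
      using B' X by (intro c) (auto simp: nsets_def card_Diff_subset)
    finally show ?thesis .
  qed
  then show False using D(3,4)
    unfolding empty_design_def contains_complete_def by (cases "c = 0") auto
qed

section \<open>Twins\<close>

text \<open>For a graph \<open>B\<close> this says that exchanging \<open>x\<close> and
  \<open>y\<close> is an automorphism; the edge \<open>{x, y}\<close> itself is
  unconstrained.\<close>

definition twins :: "'a set set \<Rightarrow> 'a \<Rightarrow> 'a \<Rightarrow> bool" where
  "twins B x y \<longleftrightarrow> (\<forall>u. u \<noteq> x \<longrightarrow> u \<noteq> y \<longrightarrow> ({x, u} \<in> B \<longleftrightarrow> {y, u} \<in> B))"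

lemma twins_refl [simp]: "twins B x x"
  by (simp add: twins_def)

lemma twins_sym: "twins B x y \<Longrightarrow> twins B y x"
  by (auto simp: twins_def)

text \<open>The delicate vertex is \<open>u = y\<close>: there both \<open>{x, y}\<close> and
  \<open>{z, y}\<close> are compared with \<open>{x, z}\<close>.\<close>

lemma twins_trans:
  assumes "twins B x y" "twins B y z"
  shows "twins B x z"
  using assms unfolding twins_def by (metis insert_commute)

lemma mem_image_transpose_iff:
  "{a, b} \<in> (`) (transpose x z) ` B \<longleftrightarrow> {transpose x z a, transpose x z b} \<in> B"
proof
  assume "{a, b} \<in> (`) (transpose x z) ` B"
  then obtain e where e: "e \<in> B" "{a, b} = transpose x z ` e" by auto
  have "transpose x z ` {a, b} = e" by (simp only: e(2) image_image) simp
  with e(1) show "{transpose x z a, transpose x z b} \<in> B" by simp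
next
  assume "{transpose x z a, transpose x z b} \<in> B"
  then have "transpose x z ` {transpose x z a, transpose x z b} \<in> (`) (transpose x z) ` B" by blast
  then show "{a, b} \<in> (`) (transpose x z) ` B" by simp
qed

lemma twins_if_transpose_fixes:
  assumes "(`) (transpose x z) ` B = B"
  shows "twins B x z"
  unfolding twins_def
proof (intro allI impI)
  fix u assume "u \<noteq> x" "u \<noteq> z"
  then show "{x, u} \<in> B \<longleftrightarrow> {z, u} \<in> B"
    using mem_image_transpose_iff[of x u x z B] assms by simp
qed

text \<open>A graph invariant under a 3-cycle of its vertices is invariant under the
  transpositions in that cycle.\<close>

lemma twins_if_transposes_agree:
  assumes "(`) (transpose x z) ` B = (`) (transpose x z') ` B" "z \<noteq> z'" "x \<noteq> z" "x \<noteq> z'"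
  shows "twins B x z"
  unfolding twins_def
proof (intro allI impI)
  have *: "{transpose x z a, transpose x z b} \<in> B \<longleftrightarrow> {transpose x z' a, transpose x z' b} \<in> B" for a b
    using mem_image_transpose_iff[of a b x z B] mem_image_transpose_iff[of a b x z' B] assms(1) by simp
  fix u assume u: "u \<noteq> x" "u \<noteq> z"
  show "{x, u} \<in> B \<longleftrightarrow> {z, u} \<in> B"
  proof (cases "u = z'")
    case False
    then show ?thesis using *[of z u] u assms by simp
  next
    case True
    then show ?thesis using *[of z z'] *[of x z'] u assms by (auto simp: insert_commute)
  qed
qed

text \<open>If \<open>x\<close> and \<open>y\<close> were not twins, each vertex of \<open>F\<close>
  would fail to be a twin of one of them, so one of the two, \<open>a\<close>, has at least
  \<open>lam\<close> non-twins in \<open>F\<close>. Transposing \<open>a\<close> with these gives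
  distinct blocks other than \<open>B\<close>, so \<open>S\<close> lies in \<open>lam + 1\<close>
  blocks.\<close>

lemma twins_outside_subset_of_block:
  assumes D: "design t v k lam (complete_edges V) \<B>" and G: "graphical V k \<B>"
    and B: "B \<in># \<B>" and S: "S \<subseteq> B" "card S = t"
    and F: "finite F" "F \<subseteq> V" "\<Union>S \<inter> F = {}" "2 * lam \<le> card F"
    and x: "x \<in> F" and y: "y \<in> F"
  shows "twins B x y"
proof (rule ccontr)
  assume ntw: "\<not> twins B x y"
  have Bk: "B \<in> nsets (complete_edges V) k" using D B by (auto simp: design_def)
  have fS: "S \<in> nsets (complete_edges V) t" using Bk S by (auto simp: nsets_def finite_subset)
  define N where "N a = {z \<in> F. \<not> twins B a z}" for a
  have "F \<subseteq> N x \<union> N y" using ntw twins_trans[OF _ twins_sym, of B x _ y] by (auto simp: N_def)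
  then have "card F \<le> card (N x) + card (N y)"
    using F(1) card_Un_le[of "N x" "N y"] card_mono[of "N x \<union> N y" F] by (simp add: N_def)
  then obtain a where a: "a \<in> F" "lam \<le> card (N a)" using F(4) x y by (cases "lam \<le> card (N x)") auto
  have fin: "finite (N a)" using F(1) by (simp add: N_def)
  define im where "im z = (`) (transpose a z) ` B" for z
  have inj: "inj_on im (N a)"
  proof (rule inj_onI)
    fix z z' assume z: "z \<in> N a" "z' \<in> N a" "im z = im z'"
    show "z = z'"
    proof (rule ccontr)
      assume "z \<noteq> z'"
      moreover have "a \<noteq> z" "a \<noteq> z'" using z by (auto simp: N_def)
      ultimately have "twins B a z" using z(3) by (auto simp: im_def intro: twins_if_transposes_agree)
      then show False using z(1) by (simp add: N_def)
    qed
  qed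
  have notin: "B \<notin> im ` N a"
  proof
    assume "B \<in> im ` N a"
    then obtain z where "z \<in> N a" "im z = B" by blast
    then show False using twins_if_transpose_fixes[of a z B] by (simp add: N_def im_def)
  qed
  have "im z \<in># \<B> \<and> S \<subseteq> im z" if z: "z \<in> N a" for z
  proof -
    have zF: "z \<in> F" using z by (simp add: N_def)
    have "transpose a z permutes V" using zF a F(2) by (auto intro: permutes_swap_id)
    then have "count \<B> (im z) = count \<B> B" using G Bk by (simp add: graphical_def im_def)
    then have 1: "im z \<in># \<B>" using B by (metis count_greater_zero_iff)
    have "s \<in> im z" if s: "s \<in> S" for s
    proof -
      have "a \<notin> s" "z \<notin> s" using s a zF F(3) by auto
      then have "transpose a z ` s = s" by (auto simp: transpose_def image_iff)
      then show ?thesis using s S(1) by (metis im_def image_eqI subsetD)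
    qed
    with 1 show ?thesis by blast
  qed
  then have sub: "insert B (im ` N a) \<subseteq> set_mset {#C \<in># \<B>. S \<subseteq> C#}" using B S by auto
  have "Suc lam \<le> card (insert B (im ` N a))"
    using a inj notin fin by (simp add: card_image)
  also have "\<dots> \<le> card (set_mset {#C \<in># \<B>. S \<subseteq> C#})" by (intro card_mono sub) simp
  also have "\<dots> \<le> size {#C \<in># \<B>. S \<subseteq> C#}"
    by (metis size_mset_mono mset_set_set_mset_msubset size_mset_set)
  also have "\<dots> = lam" using D fS by (auto simp: design_def)
  finally show False by simp
qed

text \<open>The edge \<open>{p, q}\<close> is moved to \<open>{a, b}\<close> one endpoint at a time;
  for \<open>b = p\<close> a single replacement is enough.\<close>

lemma complete_if_all_twins:
  assumes tw: "\<And>a b. a \<in> C \<Longrightarrow> b \<in> C \<Longrightarrow> twins B a b"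
    and pq: "{p, q} \<in> B" "p \<in> C" "q \<in> C" "p \<noteq> q"
    and ab: "a \<in> C" "b \<in> C" "a \<noteq> b"
  shows "{a, b} \<in> B"
proof (cases "b = p")
  case True
  then have "{q, b} \<in> B \<longleftrightarrow> {a, b} \<in> B"
    using tw[OF pq(3) ab(1)] ab pq by (auto simp: twins_def)
  then show ?thesis using pq True by (simp add: insert_commute)
next
  case False
  then have "{q, p} \<in> B \<longleftrightarrow> {b, p} \<in> B"
    using tw[OF pq(3) ab(2)] pq by (auto simp: twins_def)
  moreover have "{p, b} \<in> B \<longleftrightarrow> {a, b} \<in> B"
    using tw[OF pq(2) ab(1)] False ab by (auto simp: twins_def)
  ultimately show ?thesis using pq by (simp add: insert_commute)
qed

section \<open>Bounding the number of vertices\<close>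

text \<open>Here \<open>p\<close> vertices carry \<open>t - 2\<close> edges, and \<open>z\<close> vertices carry two more edges than there can be
  at one of those \<open>p\<close> vertices.\<close>

lemma graphical_design_vertices_bound:
  assumes lam: "0 < lam" and V: "finite V" "card V = n"
    and D: "design t v k lam (complete_edges V) \<B>" and G: "graphical V k \<B>"
    and t2: "2 \<le> t" and tk: "t < k" and kn: "k < n choose 2"
    and p: "t - 2 \<le> p choose 2" and z: "p + 1 \<le> z choose 2"
  shows "n < p + z + 2 * lam + 6"
proof (rule ccontr)
  assume "\<not> n < p + z + 2 * lam + 6"
  then have nb: "p + z + 2 * lam + 6 \<le> n" by simp
  have z2: "2 \<le> z" using z by (cases "z < 2") (auto simp: binomial_eq_0)
  obtain U where U: "U \<subseteq> V" "card U = p" "finite U"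
    using obtain_subset_with_card_n[of p V] nb V by auto
  define W where "W = V - U"
  have W: "finite W" "W \<subseteq> V" "U \<inter> W = {}" "V = U \<union> W" "card W = n - p"
    using U V by (auto simp: W_def card_Diff_subset)
  have cW: "z + 2 * lam + 6 \<le> card W" using nb W by simp
  obtain R where R: "R \<subseteq> nsets U 2" "card R = t - 2" "finite R"
    using obtain_subset_with_card_n[of "t - 2" "nsets U 2"] p U(2) by (auto simp: card_nsets)
  have RU: "r \<subseteq> U" "card r = 2" if "r \<in> R" for r using that R by (auto simp: nsets_def)
  have Rt: "card (R \<union> {e, e'}) = t" if "e \<noteq> e'" "\<not> e \<subseteq> U" "\<not> e' \<subseteq> U" for e e'
  proof -
    have "R \<inter> {e, e'} = {}" using that RU by auto
    then show ?thesis using R t2 that by (simp add: card_Un_disjoint)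
  qed

  \<comment> \<open>Two disjoint edges are taken so that exchanging one of them for another edge of
    the block can free both its ends.\<close>
  obtain Q where Q: "Q \<subseteq> W" "card Q = 4" using obtain_subset_with_card_n[of 4 W] cW by auto
  obtain x1 Q' where x1: "Q = insert x1 Q'" "x1 \<notin> Q'" "card Q' = 3"
    using Q card_Suc_eq[of Q 3] by auto
  then obtain y1 x2 y2 where "Q' = {y1, x2, y2}" "y1 \<noteq> x2" "x2 \<noteq> y2" "y1 \<noteq> y2"
    by (auto simp: card_3_iff)
  with x1 Q have xy: "x1 \<in> W" "y1 \<in> W" "x2 \<in> W" "y2 \<in> W" "distinct [x1, y1, x2, y2]" by auto
  define e1 where "e1 = {x1, y1}"
  define e2 where "e2 = {x2, y2}"
  have e12: "e1 \<subseteq> W" "e2 \<subseteq> W" "e1 \<inter> e2 = {}" "e1 \<noteq> {}" "e2 \<noteq> {}" "card (e1 \<union> e2) = 4"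
    using xy by (auto simp: e1_def e2_def)
  define S where "S = R \<union> {e1, e2}"
  have out: "\<not> e \<subseteq> U" if "e \<subseteq> W" "e \<noteq> {}" for e using that W by blast
  have cS: "card S = t" using Rt[of e1 e2] out[of e1] out[of e2] e12 by (auto simp: S_def)
  have "S \<subseteq> complete_edges V"
    using nsets_mono[of U V 2] R U W xy by (auto simp: S_def complete_edges_def nsets_def e1_def e2_def)
  then have "S \<in> nsets (complete_edges V) t"
    using cS R by (auto simp: nsets_def S_def)
  then have "size {#B \<in># \<B>. S \<subseteq> B#} \<noteq> 0" using D lam by (auto simp: design_def)
  then have "{#B \<in># \<B>. S \<subseteq> B#} \<noteq> {#}" by auto
  then obtain B where B: "B \<in># \<B>" "S \<subseteq> B" by (auto elim!: multiset_nonemptyE)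
  then have BV: "B \<subseteq> complete_edges V" "card B = k" "finite B"
    using D by (auto simp: design_def nsets_def)

  \<comment> \<open>Each use removes at most \<open>z + 6\<close> vertices from \<open>W\<close>,
    which leaves \<open>2 * lam\<close> of them for the twin lemma. The vertices \<open>a\<close>
    and \<open>b\<close> may also lie in \<open>U\<close>.\<close>
  have key: "twins B a b"
    if "S' \<subseteq> B" "card S' = t" "\<Union>S' \<subseteq> U \<union> Q" "finite Q" "card Q \<le> z + 6"
      "a \<in> V" "b \<in> V" "a \<notin> \<Union>S'" "b \<notin> \<Union>S'" for S' Q a b
  proof (rule twins_outside_subset_of_block[OF D G B(1)])
    let ?F = "(W - Q) \<union> {a, b}"
    have "2 * lam \<le> card W - card Q" using cW that by simp
    also have "\<dots> \<le> card (W - Q)" using that by (intro diff_card_le_card_Diff) auto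
    also have "\<dots> \<le> card ?F" using W by (intro card_mono) auto
    finally show "2 * lam \<le> card ?F" .
    show "\<Union>S' \<inter> ?F = {}" using that W by auto
  qed (use that W in auto)

  \<comment> \<open>As \<open>t < k\<close>, the block has an edge beyond \<open>S\<close>, to be
    exchanged for \<open>e1\<close> or \<open>e2\<close>. The vertices \<open>w\<close>,
    \<open>w'\<close>, \<open>w''\<close> below are spare ones on none of these three edges.\<close>
  obtain f where f: "f \<in> B" "f \<notin> S"
  proof -
    have "S \<noteq> B" using tk BV cS by auto
    then show ?thesis using that B by blast
  qed
  have f2: "f \<subseteq> V" "card f = 2" "finite f" using f BV by (auto simp: complete_edges_def nsets_def)
  have "card (e1 \<union> e2 \<union> f) \<le> 6" using card_Un_le[of "e1 \<union> e2" f] e12 f2 by simp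
  then have "3 \<le> card (W - (e1 \<union> e2 \<union> f))"
    using diff_card_le_card_Diff[of "e1 \<union> e2 \<union> f" W] cW z2 lam f2 by (simp add: e1_def e2_def)
  then obtain Q where "Q \<subseteq> W - (e1 \<union> e2 \<union> f)" "card Q = 3"
    using obtain_subset_with_card_n by metis
  then obtain w w' w'' where w: "w \<in> W - (e1 \<union> e2 \<union> f)" "w' \<in> W - (e1 \<union> e2 \<union> f)"
    "w'' \<in> W - (e1 \<union> e2 \<union> f)" "w \<noteq> w'" "w' \<noteq> w''" "w \<noteq> w''"
    by (auto simp: card_3_iff)

  have S1: "R \<union> {f, e'} \<subseteq> B" "card (R \<union> {f, e'}) = t" if "e' = e1 \<or> e' = e2" for e'
  proof -
    have "\<not> e' \<subseteq> U" using that out[of e1] out[of e2] e12 by auto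
    then have "e' \<notin> R" using RU(1) by blast
    then have e': "e' \<in> S" "e' \<notin> R" "f \<noteq> e'" "f \<notin> R"
      using that f by (auto simp: S_def)
    then show "R \<union> {f, e'} \<subseteq> B" using B f by (auto simp: S_def)
    show "card (R \<union> {f, e'}) = t" using e' R t2 by simp
  qed
  have RU': "\<Union>R \<subseteq> U" using RU by auto
  have A: "twins B a w" if a: "a \<in> W" "a \<notin> f \<or> a \<notin> e1 \<union> e2" for a
  proof -
    have notR: "c \<notin> \<Union>R" if "c \<in> W" for c using that RU' W by auto
    have fin: "finite e1" "finite e2" "card e1 = 2" "card e2 = 2" using xy by (auto simp: e1_def e2_def)
    have aV: "a \<in> V" "w \<in> V" using a w W by auto
    \<comment> \<open>A vertex off \<open>e1\<close> and \<open>e2\<close> is already missed by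
      \<open>S\<close>; one on \<open>e1\<close> or \<open>e2\<close> but off \<open>f\<close>
      becomes free when its edge is exchanged for \<open>f\<close>.\<close>
    consider "a \<notin> e1 \<union> e2" | "a \<notin> f" "a \<notin> e2" | "a \<notin> f" "a \<notin> e1" using a e12 by blast
    then show ?thesis
    proof cases
      case 1
      show ?thesis
      proof (rule key[OF B(2) cS _ _ _ aV])
        show "\<Union>S \<subseteq> U \<union> (e1 \<union> e2)" using RU' by (simp add: S_def) blast
        show "a \<notin> \<Union>S" "w \<notin> \<Union>S" using 1 a(1) w(1) notR by (auto simp: S_def)
      qed (use fin e12 in simp_all)
    next
      case 2
      have e: "e2 = e1 \<or> e2 = e2" by simp
      show ?thesis
      proof (rule key[OF S1[OF e] _ _ _ aV])
        show "\<Union>(R \<union> {f, e2}) \<subseteq> U \<union> (f \<union> e2)" using RU' by simp blast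
        show "a \<notin> \<Union>(R \<union> {f, e2})" "w \<notin> \<Union>(R \<union> {f, e2})"
          using 2 a(1) w(1) notR by auto
        show "card (f \<union> e2) \<le> z + 6" using card_Un_le[of f e2] f2 fin by simp
      qed (use fin f2 in simp_all)
    next
      case 3
      have e: "e1 = e1 \<or> e1 = e2" by simp
      show ?thesis
      proof (rule key[OF S1[OF e] _ _ _ aV])
        show "\<Union>(R \<union> {f, e1}) \<subseteq> U \<union> (f \<union> e1)" using RU' by simp blast
        show "a \<notin> \<Union>(R \<union> {f, e1})" "w \<notin> \<Union>(R \<union> {f, e1})"
          using 3 a(1) w(1) notR by auto
        show "card (f \<union> e1) \<le> z + 6" using card_Un_le[of f e1] f2 fin by simp
      qed (use fin f2 in simp_all)
    qed
  qed

  \<comment> \<open>A path of two edges in \<open>W\<close> completes \<open>R\<close> to a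
    \<open>t\<close>-set touching only three vertices of \<open>W\<close>.\<close>
  have cherry: "twins B a b"
    if "{c, d} \<in> B" "{c, d'} \<in> B" "{c, d, d'} \<subseteq> W" "d \<noteq> d'" "c \<noteq> d" "c \<noteq> d'"
      "a \<in> W - {c, d, d'}" "b \<in> W - {c, d, d'}" for a b c d d'
  proof (rule key[of "R \<union> {{c, d}, {c, d'}}" "{c, d, d'}"])
    show "card (R \<union> {{c, d}, {c, d'}}) = t"
      using that W by (intro Rt) (auto simp: doubleton_eq_iff)
    show "card {c, d, d'} \<le> z + 6" using that by simp
    show "\<Union>(R \<union> {{c, d}, {c, d'}}) \<subseteq> U \<union> {c, d, d'}" using RU' by auto
    show "R \<union> {{c, d}, {c, d'}} \<subseteq> B" using that B by (simp add: S_def)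
    show "a \<in> V" "b \<in> V" using that W by auto
    have "a \<notin> U" "b \<notin> U" using that W by auto
    then show "a \<notin> \<Union>(R \<union> {{c, d}, {c, d'}})" "b \<notin> \<Union>(R \<union> {{c, d}, {c, d'}})"
      using that RU' by auto
  qed simp

  \<comment> \<open>One exceptional vertex \<open>x\<close> is tolerable. Taking it on
    \<open>e1\<close> or \<open>e2\<close> leaves one of these edges inside \<open>W - {x}\<close>
    and the other at \<open>x\<close>.\<close>
  obtain x where x: "x \<in> e1 \<union> e2" "\<And>a. a \<in> W - {x} \<Longrightarrow> twins B a w"
  proof (cases "\<exists>x\<in>e1 \<union> e2. f \<inter> (e1 \<union> e2) \<subseteq> {x}")
    case True
    then show ?thesis using A that by blast
  next
    case False
    \<comment> \<open>\<open>f\<close> joins two of the four vertices, so the choices of \<open>S\<close> made so far never free its ends.\<close>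
    then obtain \<alpha> where \<alpha>: "\<alpha> \<in> f" "\<alpha> \<in> e1 \<union> e2" using e12 by blast
    then obtain \<beta> where \<beta>: "\<beta> \<in> f" "\<beta> \<in> e1 \<union> e2" "\<beta> \<noteq> \<alpha>" using False by blast
    have fab: "f = {\<alpha>, \<beta>}" using \<alpha> \<beta> f2 card_subset_eq[of f "{\<alpha>, \<beta>}"] by auto
    \<comment> \<open>The partner \<open>\<gamma>\<close> of \<open>\<alpha>\<close> is off
      \<open>f\<close>, hence a twin of \<open>w\<close> and \<open>w'\<close>; the edge
      \<open>{\<gamma>, \<alpha>}\<close> thus yields the path \<open>w\<close>,
      \<open>\<alpha>\<close>, \<open>w'\<close>. This path misses \<open>\<beta>\<close>, so only
      \<open>\<alpha>\<close> stays exceptional.\<close>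
    obtain \<gamma> where \<gamma>: "{\<gamma>, \<alpha>} \<in> {e1, e2}" "\<gamma> \<noteq> \<alpha>"
      using \<alpha> xy by (auto simp: e1_def e2_def doubleton_eq_iff)
    have "\<gamma> \<noteq> \<beta>" using \<gamma> f fab by (auto simp: S_def insert_commute)
    then have \<gamma>': "\<gamma> \<notin> f" "\<gamma> \<in> W" "{\<gamma>, \<alpha>} \<in> B" using \<gamma> fab e12 B by (auto simp: S_def)
    have "twins B \<gamma> w" using A \<gamma>' by blast
    moreover have "twins B w' w" using A w by blast
    ultimately have "twins B \<gamma> w" "twins B \<gamma> w'" using twins_trans twins_sym by metis+
    then have aw: "{\<alpha>, w} \<in> B" "{\<alpha>, w'} \<in> B"
      using \<gamma>' \<gamma>(2) w \<alpha> unfolding twins_def by (auto simp: insert_commute)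
    have "twins B \<beta> w''"
      by (rule cherry[OF aw]) (use w \<alpha> \<beta> e12 in auto)
    moreover have "twins B w'' w" using A w by blast
    ultimately have "twins B \<beta> w" by (rule twins_trans)
    then show ?thesis using A \<alpha> fab that[of \<alpha>] by blast
  qed
  have x': "twins B a b" if "a \<in> W - {x}" "b \<in> W - {x}" for a b
    using x that twins_trans twins_sym by metis
  \<comment> \<open>The edge missing \<open>x\<close> makes \<open>W - {x}\<close> a clique, and the
    edge at \<open>x\<close> spreads to all its vertices.\<close>
  have KW: "{a, b} \<in> B" if ab: "a \<in> W" "b \<in> W" "a \<noteq> b" for a b
  proof -
    obtain c d where cd: "{c, d} \<in> B" "c \<in> W - {x}" "d \<in> W - {x}" "c \<noteq> d"
    proof (cases "x \<in> e1")
      case True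
      then show ?thesis using that[of x2 y2] B xy by (auto simp: e1_def e2_def S_def)
    next
      case False
      then show ?thesis using that[of x1 y1] B xy by (auto simp: e1_def e2_def S_def)
    qed
    obtain x'' where x'': "{x'', x} \<in> B" "x'' \<in> W - {x}"
    proof -
      have "\<exists>x''. {x'', x} \<in> {e1, e2} \<and> x'' \<noteq> x" using x(1) xy by (auto simp: e1_def e2_def doubleton_eq_iff)
      then show ?thesis using that e12 B by (auto simp: S_def)
    qed
    have xa: "{a, x} \<in> B" if "a \<in> W - {x}" for a
      using x'[OF x''(2) that] x'' that unfolding twins_def by auto
    show ?thesis
    proof (cases "a = x \<or> b = x")
      case True
      then show ?thesis using xa[of a] xa[of b] ab by (auto simp: insert_commute)
    next
      case False
      then show ?thesis using complete_if_all_twins[of "W - {x}", OF x' cd] ab by blast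
    qed
  qed
  have TW: "twins B a b" if ab: "a \<in> W" "b \<in> W" for a b
  proof -
    \<comment> \<open>The clique contains a path avoiding any given \<open>a\<close> and
      \<open>b\<close>, so \<open>x\<close> is no longer exceptional.\<close>
    have "3 \<le> card (W - {a, b})"
      using diff_card_le_card_Diff[of "{a, b}" W] card_insert_le_m1[of 2 "{b}" a] cW by simp
    then obtain Q where "Q \<subseteq> W - {a, b}" "card Q = 3"
      using obtain_subset_with_card_n by metis
    then obtain c d d' where "c \<in> W - {a, b}" "d \<in> W - {a, b}" "d' \<in> W - {a, b}" "c \<noteq> d" "d \<noteq> d'" "c \<noteq> d'"
      by (auto simp: card_3_iff)
    then show ?thesis by (intro cherry[of c d d'] KW) (use ab in auto)
  qed

  obtain Z where Z: "Z \<subseteq> W" "card Z = z" "finite Z"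
    using obtain_subset_with_card_n[of z W] cW W by (auto intro: finite_subset)
  have ZB: "nsets Z 2 \<subseteq> B" using KW Z by (fastforce simp: nsets_def card_2_iff)
  have "\<not> W \<subseteq> Z" using cW Z card_mono[of Z W] by auto
  then obtain b where b: "b \<in> W" "b \<notin> Z" by blast
  have TU: "twins B u b" if u: "u \<in> U" for u
  proof -
    \<comment> \<open>At most \<open>p - 1\<close> edges of \<open>R\<close> contain
      \<open>u\<close>. These, together with \<open>e1\<close> and \<open>e2\<close>, are traded for
      equally many edges of the clique on \<open>Z\<close>; hence the requirement
      \<open>p + 1 \<le> z choose 2\<close>.\<close>
    define Ru where "Ru = {r \<in> R. u \<in> r}"
    have "Ru \<subseteq> (\<lambda>v. {u, v}) ` (U - {u})"
    proof
      fix r assume "r \<in> Ru"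
      then have r: "u \<in> r" "r \<subseteq> U" "card r = 2" using RU by (auto simp: Ru_def)
      then obtain c where "r = {u, c}" "c \<noteq> u" by (auto simp: card_2_iff)
      then show "r \<in> (\<lambda>v. {u, v}) ` (U - {u})" using r by auto
    qed
    then have "card Ru \<le> card ((\<lambda>v. {u, v}) ` (U - {u}))" using U by (intro card_mono) auto
    also have "\<dots> \<le> card (U - {u})" using U by (intro card_image_le) auto
    also have "\<dots> < p" using card_Diff1_less[OF U(3) u] U(2) by simp
    finally have "card Ru + 2 \<le> card (nsets Z 2)" using z Z by (simp add: card_nsets)
    then obtain Y where Y: "Y \<subseteq> nsets Z 2" "card Y = card Ru + 2" "finite Y"
      using obtain_subset_with_card_n by metis
    have fin: "finite Ru" "Ru \<subseteq> R" using R by (auto simp: Ru_def)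
    have "y \<notin> R" if "y \<in> Y" for y
    proof -
      have "y \<subseteq> Z" "card y = 2" using that Y by (auto simp: nsets_def)
      moreover have "Z \<inter> U = {}" using Z W by blast
      ultimately show ?thesis using RU(1)[of y] by (cases "y = {}") auto
    qed
    then have "card (R - Ru \<union> Y) = card (R - Ru) + card Y"
      using R Y by (intro card_Un_disjoint) auto
    moreover have "card Ru \<le> card R" using fin R by (intro card_mono) auto
    ultimately have ct: "card (R - Ru \<union> Y) = t"
      using R Y fin t2 by (simp add: card_Diff_subset)
    have YZ: "\<Union>Y \<subseteq> Z" using Y by (auto simp: nsets_def)
    show ?thesis
    proof (rule key[OF _ ct, of Z])
      show "R - Ru \<union> Y \<subseteq> B" using B Y ZB by (auto simp: S_def)
      show "\<Union> (R - Ru \<union> Y) \<subseteq> U \<union> Z" using RU' YZ by blast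
      have uZ: "u \<notin> Z" using u Z W by blast
      show "u \<notin> \<Union> (R - Ru \<union> Y)" using YZ uZ by (auto simp: Ru_def)
      show "b \<notin> \<Union> (R - Ru \<union> Y)" using YZ RU' b W by blast
    qed (use Z u b W in auto)
  qed
  have "twins B a b" if "a \<in> V" for a using that TU TW b W by blast
  then have "twins B a c" if "a \<in> V" "c \<in> V" for a c using that twins_trans twins_sym by metis
  then have "{a, c} \<in> B" if "a \<in> V" "c \<in> V" "a \<noteq> c" for a c
    using complete_if_all_twins[of V B x1 y1 a c] that B xy W by (auto simp: S_def e1_def)
  then have "nsets V 2 \<subseteq> B" by (fastforce simp: nsets_def card_2_iff)
  then have "n choose 2 \<le> k" using card_mono[OF BV(3)] BV V by (metis card_nsets)
  with kn show False by simp
qed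

section \<open>Explicit constants\<close>

lemma real_choose_two: "real (m choose 2) = real m * (real m - 1) / 2"
proof -
  have "even (m * (m - 1))" by (cases m) auto
  then have "2 * (m choose 2) = m * (m - 1)" by (simp add: choose_two del: even_mult_iff)
  then have "2 * real (m choose 2) = real m * real (m - 1)"
    by (metis of_nat_mult of_nat_numeral)
  then show ?thesis by (cases m) auto
qed

theorem theorem5p7:
  fixes V :: "'a set" and \<B> :: "'a set set multiset" and n t k lam :: nat
  assumes "0 < lam"
    and "finite V" and "card V = n"
    and "nontrivial_design t (n choose 2) k lam (complete_edges V) \<B>"
    and "graphical V k \<B>"
    and "2 \<le> t"
  shows "real t < 2.3 * real (T_bound lam) ^ 2 \<and>
         real n < 4.7 * real (T_bound lam) ^ 2 \<and>
         real k < 11.1 * real (T_bound lam) ^ 4"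
proof -
  define T where "T = real (T_bound lam)"
  have T: "10 ^ 5 \<le> T" "7 * real lam + 43 \<le> T" by (auto simp: T_def T_bound_def max_def)
  have D: "design t (n choose 2) k lam (complete_edges V) \<B>" "t < k" "k < n choose 2"
    using assms(4) by (auto simp: nontrivial_design_def)
  have bound: "real n < real p + real z + 2 * real lam + 6"
    if "real t \<le> real p * (real p - 1) / 2" "real p + 1 \<le> real z * (real z - 1) / 2" for p z
  proof -
    have "real t \<le> real (p choose 2)" "real (p + 1) \<le> real (z choose 2)"
      using that by (simp_all add: real_choose_two)
    then have "t - 2 \<le> p choose 2" "p + 1 \<le> z choose 2" by (simp_all only: of_nat_le_iff)
    then have "n < p + z + 2 * lam + 6"
      by (rule graphical_design_vertices_bound[OF assms(1-3) D(1) assms(5,6) D(2,3)])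
    then show ?thesis by simp
  qed
  have TT: "10 ^ 5 * T \<le> T ^ 2" using T(1) by (simp add: power2_eq_square)

  have t: "real t < 2.3 * T ^ 2"
  proof (rule ccontr)
    assume "\<not> real t < 2.3 * T ^ 2"
    then have tT: "2.3 * T ^ 2 \<le> real t" by simp
    define s where "s = sqrt (real t)"
    have s2: "s ^ 2 = real t" by (simp add: s_def)
    have "(1.5 * T) ^ 2 = 9 / 4 * T ^ 2" by (simp add: power2_eq_square)
    also have "\<dots> \<le> s ^ 2" using tT zero_le_power2[of T] unfolding s2 by linarith
    finally have "(1.5 * T) ^ 2 \<le> s ^ 2" .
    then have sT: "1.5 * T \<le> s" by (rule power2_le_imp_le) (simp add: s_def)
    have s5: "10 ^ 5 \<le> s" using sT T by simp
    have ss: "10 ^ 5 * s \<le> s ^ 2" using s5 by (simp add: power2_eq_square)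
    \<comment> \<open>Combines \<open>k + t < n choose 2\<close> with \<open>t < k\<close>.\<close>
    have "2 * t < n choose 2" using nontrivial_design_bound[OF assms(4)] D by simp
    then have "2 * real t < real (n choose 2)" by (metis of_nat_less_iff of_nat_mult of_nat_numeral)
    then have "4 * real t < real n * (real n - 1)" by (simp add: real_choose_two)
    then have "(2 * s) ^ 2 < real n ^ 2"
      using s2 by (simp add: algebra_simps power2_eq_square)
    then have ns: "2 * s < real n" by (rule power2_less_imp_less) simp
    \<comment> \<open>Since \<open>1.5\<close> exceeds \<open>sqrt 2\<close>,
      \<open>p choose 2\<close> reaches \<open>t\<close>; for \<open>s \<ge> 10 ^ 5\<close> the
      quadratic \<open>z choose 2\<close> exceeds \<open>p\<close>. About \<open>1.6 * s\<close>
      vertices are spent out of more than \<open>2 * s\<close>, and the gap \<open>0.4 * s\<close>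
      exceeds \<open>2 * lam + 8\<close> because \<open>s \<ge> 1.5 * T\<close>.\<close>
    define p where "p = nat \<lceil>1.5 * s\<rceil>"
    define z where "z = nat \<lceil>0.1 * s\<rceil>"
    have ceil: "a \<le> real (nat \<lceil>a\<rceil>)" "real (nat \<lceil>a\<rceil>) \<le> a + 1" if "0 \<le> a" for a :: real
      using that ceiling_correct[of a] by (auto simp: of_nat_nat)
    have p: "1.5 * s \<le> real p" "real p \<le> 1.5 * s + 1"
      using s5 unfolding p_def by (intro ceil; simp)+
    have z: "0.1 * s \<le> real z" "real z \<le> 0.1 * s + 1"
      using s5 unfolding z_def by (intro ceil; simp)+
    have "(1.5 * s) * (1.5 * s - 1) \<le> real p * (real p - 1)" using p s5 by (intro mult_mono) auto
    then have 1: "real t \<le> real p * (real p - 1) / 2"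
      using ss s5 s2 by (simp add: algebra_simps power2_eq_square)
    have "(0.1 * s) * (0.1 * s - 1) \<le> real z * (real z - 1)" using z s5 by (intro mult_mono) auto
    then have 2: "real p + 1 \<le> real z * (real z - 1) / 2"
      using ss s5 s2 p by (simp add: algebra_simps power2_eq_square)
    show False using bound[OF 1 2] ns p z sT T s5 by simp
  qed

  have n: "real n < 4.7 * T ^ 2"
  proof -
    \<comment> \<open>With \<open>p = z = 3 * T\<close> the binomial is about
      \<open>4.5 * T ^ 2\<close>, above the bound on \<open>t\<close>; the resulting bound on
      \<open>n\<close> is even linear in \<open>T\<close>.\<close>
    have r: "real (3 * T_bound lam) = 3 * T" by (simp add: T_def)
    have "3 * T * (3 * T - 1) / 2 = 4.5 * T ^ 2 - 1.5 * T"
      by (simp add: field_simps power2_eq_square)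
    then have "2.3 * T ^ 2 \<le> 3 * T * (3 * T - 1) / 2" "3 * T + 1 \<le> 3 * T * (3 * T - 1) / 2"
      using TT T by simp_all
    then have "real n < 3 * T + 3 * T + 2 * real lam + 6"
      using bound[of "3 * T_bound lam" "3 * T_bound lam"] t unfolding r by simp
    then show ?thesis using TT T by simp
  qed

  \<comment> \<open>The constant is \<open>4.7 ^ 2 / 2 = 11.045\<close>.\<close>
  have "real k < real n * (real n - 1) / 2" using D(3) by (simp flip: real_choose_two)
  also have "\<dots> \<le> real n ^ 2 / 2" by (simp add: power2_eq_square algebra_simps)
  also have "\<dots> \<le> (4.7 * T ^ 2) ^ 2 / 2" using n by (intro divide_right_mono power_mono) auto
  also have "\<dots> = 2209 / 200 * T ^ 4" by (simp add: power2_eq_square power4_eq_xxxx)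
  also have "\<dots> < 11.1 * T ^ 4" using T by simp
  finally show ?thesis using t n by (simp add: T_def)
qed
end
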